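(* Let $V$ be a finite-dimensional vector space over a field $F$ (of arbitrary characteristic), let $S\leq V$ be a subspace, and let $Q\colon S\to F$ be a quadratic form with polar form $B$ and radical $R$ of $B$, such that $Q(x)=0$ for all $x\in R\setminus\{0\}$. Let $\hat Q\colon\hat S\to F$ be the dual quadratic form of $Q$, where $\hat S=\operatorname{ann}_V(R)\leq V^*$. Furthermore, let $\psi\in\operatorname{GL}(V)$ and $c\in F\setminus\{0\}$. Then the following statements are equivalent: (a) $\psi(S)=S$ and $Q\bigl(\psi(x)\bigr)=c\,Q(x)$ for all $x\in S$. (b) $\psi^{\mathrm T}(\hat S)=\hat S$ and $\hat Q\bigl(\psi^{\mathrm T}(a^* )\bigr)=c\,\hat Q(a^* )$ for all $a^*\in\hat S$.
   Context: A quadratic form $Q\colon S\to F$ on an $F$-vector space $S$ is a map with $Q(cx)=c^2Q(x)$ for all $c\in F$, $x\in S$, and such that its polar form $B\colon S\times S\to F$, $B(x,y):=Q(x+y)-Q(x)-Q(y)$, is bilinear. The radical of $B$ is $R:=\{x\in S\mid B(x,y)=0\text{ for all }y\in S\}$. $V^*$ is the dual space of $V$, $\langle a^*,x\rangle_V:=a^*(x)$ for $a^*\in V^*$, $x\in V$, and for $M\subseteq V$, $\operatorname{ann}_V(M):=\{a^*\in V^*\mid\langle a^*,m\rangle_V=0\text{ for all }m\in M\}$. A linear form $a^*\in\hat S:=\operatorname{ann}_V(R)$ is $B$-linked to $x\in S$, written $a^*\mathrel{\lozenge}x$, if and only if $\langle a^*,y\rangle_V=B(x,y)$ for all $y\in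 S$. Dual quadratic form: if $Q$ vanishes on the radical $R$ of its polar form, there is a unique mapping $\hat Q\colon\hat S\to F$ such that $a^*\mathrel{\lozenge}x$ implies $\hat Q(a^* )=Q(x)$ (for $a^*\in\hat S$, $x\in S$); it is a quadratic form and is called the dual quadratic form of $Q$. $\operatorname{GL}(V)$ is the group of linear bijections $V\to V$. The transpose of $\psi$ is the linear map $\psi^{\mathrm T}\colon V^*\to V^*$, $a^*\mapsto a^*\circ\psi$. *)

theory Defs
  imports "HOL.Vector_Spaces" "HOL-Library.FuncSet"
begin

text \<open>
  The ambient space \<open>V\<close> is a whole type with scalar multiplication \<open>scale\<close>; a form on a
  subspace \<open>S\<close> is a total function of which only the values on \<open>S\<close> matter.
\<close>

definition polar :: "('v::ab_group_add \<Rightarrow> 'f::field) \<Rightarrow> 'v \<Rightarrow> 'v \<Rightarrow> 'f" where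
  "polar Q x y = Q (x + y) - Q x - Q y"

definition linear_form_on ::
    "('f::field \<Rightarrow> 'v::ab_group_add \<Rightarrow> 'v) \<Rightarrow> 'v set \<Rightarrow> ('v \<Rightarrow> 'f) \<Rightarrow> bool" where
  "linear_form_on scale S f \<longleftrightarrow>
     (\<forall>x\<in>S. \<forall>y\<in>S. f (x + y) = f x + f y) \<and> (\<forall>c. \<forall>x\<in>S. f (scale c x) = c * f x)"

definition bilinear_form_on ::
    "('f::field \<Rightarrow> 'v::ab_group_add \<Rightarrow> 'v) \<Rightarrow> 'v set \<Rightarrow> ('v \<Rightarrow> 'v \<Rightarrow> 'f) \<Rightarrow> bool" where
  "bilinear_form_on scale S B \<longleftrightarrow>
     (\<forall>x\<in>S. linear_form_on scale S (\<lambda>y. B x y)) \<and> (\<forall>y\<in>S. linear_form_on scale S (\<lambda>x. B x y))"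

definition quadratic_form_on ::
    "('f::field \<Rightarrow> 'v::ab_group_add \<Rightarrow> 'v) \<Rightarrow> 'v set \<Rightarrow> ('v \<Rightarrow> 'f) \<Rightarrow> bool" where
  "quadratic_form_on scale S Q \<longleftrightarrow>
     (\<forall>c. \<forall>x\<in>S. Q (scale c x) = c\<^sup>2 * Q x) \<and> bilinear_form_on scale S (polar Q)"

definition radical :: "'v::ab_group_add set \<Rightarrow> ('v \<Rightarrow> 'f::field) \<Rightarrow> 'v set" where
  "radical S Q = {x \<in> S. \<forall>y\<in>S. polar Q x y = 0}"

definition dual_space :: "('f::field \<Rightarrow> 'v::ab_group_add \<Rightarrow> 'v) \<Rightarrow> ('v \<Rightarrow> 'f) set" where
  "dual_space scale = {a. Vector_Spaces.linear scale (*) a}"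

definition annihilator ::
    "('f::field \<Rightarrow> 'v::ab_group_add \<Rightarrow> 'v) \<Rightarrow> 'v set \<Rightarrow> ('v \<Rightarrow> 'f) set" where
  "annihilator scale M = {a \<in> dual_space scale. \<forall>m\<in>M. a m = 0}"

definition dual_domain ::
    "('f::field \<Rightarrow> 'v::ab_group_add \<Rightarrow> 'v) \<Rightarrow> 'v set \<Rightarrow> ('v \<Rightarrow> 'f) \<Rightarrow> ('v \<Rightarrow> 'f) set" where
  "dual_domain scale S Q = annihilator scale (radical S Q)"

definition linked :: "'v::ab_group_add set \<Rightarrow> ('v \<Rightarrow> 'f::field) \<Rightarrow> ('v \<Rightarrow> 'f) \<Rightarrow> 'v \<Rightarrow> bool" where
  "linked S Q a x \<longleftrightarrow> (\<forall>y\<in>S. a y = polar Q x y)"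

text \<open>
  The dual form is the unique function on \<open>dual_domain\<close> compatible with linkage; it exists
  when \<open>V\<close> is finite-dimensional and \<open>Q\<close> is a quadratic form on \<open>S\<close> vanishing on its radical.
  The condition \<open>extensional\<close> fixes the irrelevant values outside
  \<open>dual_domain\<close>, without which uniqueness would fail.
\<close>

definition dual_quadratic_form ::
    "('f::field \<Rightarrow> 'v::ab_group_add \<Rightarrow> 'v) \<Rightarrow> 'v set \<Rightarrow> ('v \<Rightarrow> 'f) \<Rightarrow> ('v \<Rightarrow> 'f) \<Rightarrow> 'f" where
  "dual_quadratic_form scale S Q =
     (THE Q'. Q' \<in> extensional (dual_domain scale S Q) \<and>
        (\<forall>a\<in>dual_domain scale S Q. \<forall>x\<in>S. linked S Q a x \<longrightarrow> Q' a = Q x))"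

definition general_linear_group ::
    "('f::field \<Rightarrow> 'v::ab_group_add \<Rightarrow> 'v) \<Rightarrow> ('v \<Rightarrow> 'v) set" where
  "general_linear_group scale = {\<psi>. Vector_Spaces.linear scale scale \<psi> \<and> bij \<psi>}"

definition transpose_map :: "('v \<Rightarrow> 'v) \<Rightarrow> ('v \<Rightarrow> 'f) \<Rightarrow> 'v \<Rightarrow> 'f" where
  "transpose_map \<psi> a = a \<circ> \<psi>"

end

theory Submission
  imports Defs
begin

text \<open>
  Nondegenerate pairing: every \<open>a\<close> in the dual domain is linked to some \<open>x \<in> S\<close>, every \<open>x \<in> S\<close> to some
  \<open>a\<close>, and if \<open>b\<close> is linked to \<open>y\<close>, then the polar form of the dual form
  at \<open>(a, b)\<close> is \<open>a y\<close>. A similitude \<open>\<psi>\<close> with multiplier \<open>c\<close> turns a link from \<open>a\<close>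
  to \<open>\<psi> z\<close> into a link from \<open>a \<circ> \<psi>\<close> to \<open>c z\<close>. Conversely, the annihilator of \<open>S\<close> is the radical
  of the dual polar form, so a similitude of the dual form preserves \<open>S\<close>; and if \<open>a\<close> is
  linked to \<open>\<psi> x\<close> and \<open>a \<circ> \<psi>\<close> to \<open>x'\<close>, then \<open>c x - x'\<close> lies in the radical, whence
  \<open>c Q (\<psi> x) = Q x' = c\<^sup>2 Q x\<close>.
\<close>

section \<open>Linear forms\<close>

lemma linear_form_on_add:
  "linear_form_on s S f \<Longrightarrow> x \<in> S \<Longrightarrow> y \<in> S \<Longrightarrow> f (x + y) = f x + f y"
  by (simp add: linear_form_on_def)

lemma linear_form_on_scale:
  "linear_form_on s S f \<Longrightarrow> x \<in> S \<Longrightarrow> f (s c x) = c * f x"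
  by (simp add: linear_form_on_def)

context vector_space
begin

lemma linear_form_on_diff:
  assumes "subspace S" "linear_form_on scale S f" "x \<in> S" "y \<in> S"
  shows "f (x - y) = f x - f y"
proof -
  have "scale (- 1) y \<in> S" using assms by (simp only: subspace_scale)
  then have "f (x + scale (- 1) y) = f x + f (scale (- 1) y)"
    using assms linear_form_on_add by blast
  then show ?thesis
    using assms linear_form_on_scale[OF assms(2,4), of "- 1"] by simp
qed

lemma linear_form_on_0:
  assumes "subspace S" "linear_form_on scale S f"
  shows "f 0 = 0"
  using linear_form_on_diff[OF assms, of 0 0] subspace_0[OF assms(1)] by simp

lemma vector_space_pair_field: "vector_space_pair scale ((*) :: 'a \<Rightarrow> 'a \<Rightarrow> 'a)"
  by unfold_locales (auto simp: algebra_simps)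

lemma dual_space_iff: "a \<in> dual_space scale \<longleftrightarrow> linear_form_on scale UNIV a"
  unfolding dual_space_def mem_Collect_eq linear_iff linear_form_on_def
  using vector_space_pair_field vector_space_axioms
  by (auto simp: vector_space_pair_def)

lemma linear_form_on_dual_space: "a \<in> dual_space scale \<Longrightarrow> linear_form_on scale S a"
  by (simp add: dual_space_iff linear_form_on_def)

section \<open>Extension and separation by linear forms\<close>

lemma linear_form_on_eq_span:
  assumes "linear_form_on scale (span B) f" "linear_form_on scale (span B) g"
    and "\<forall>x\<in>B. f x = g x" "y \<in> span B"
  shows "f y = g y"
proof -
  have "y \<in> span B \<and> f y = g y"
    using assms(4)
  proof (induction rule: span_induct_alt)
    case base
    then show ?case
      using linear_form_on_0[OF subspace_span assms(1)]
        linear_form_on_0[OF subspace_span assms(2)] span_zero by simp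
  next
    case (step c x y)
    have x: "x \<in> span B" and cx: "scale c x \<in> span B"
      using step(1) span_base span_scale by auto
    then show ?case
      using step assms(3) linear_form_on_add[OF assms(1) cx] linear_form_on_add[OF assms(2) cx]
        linear_form_on_scale[OF assms(1) x] linear_form_on_scale[OF assms(2) x]
      by (simp add: span_add)
  qed
  then show ?thesis by simp
qed

text \<open>Prescribing the values of \<open>f\<close> on a basis of \<open>S\<close> gives a global
  linear form; it agrees with \<open>f\<close> on the span of that basis, which is
  \<open>S\<close>.\<close>

lemma linear_form_on_extend:
  assumes "subspace S" "linear_form_on scale S f"
  obtains g where "g \<in> dual_space scale" "\<forall>x\<in>S. g x = f x"
proof -
  obtain B where B: "B \<subseteq> S" "independent B" "S \<subseteq> span B"
    using maximal_independent_subset[of S] by auto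
  then have S: "span B = S"
    using assms(1) span_minimal by blast
  obtain g where g: "g \<in> dual_space scale" "\<forall>x\<in>B. g x = f x"
    using vector_space_pair.linear_independent_extend[OF vector_space_pair_field B(2), of f]
    by (auto simp: dual_space_def)
  then show thesis
    using that linear_form_on_eq_span[of B g f] assms(2) linear_form_on_dual_space S by metis
qed

text \<open>A vector outside \<open>S\<close> stays independent of a basis of \<open>S\<close>, so
  some linear form is 1 on it and 0 on \<open>S\<close>. This turns membership in \<open>S\<close>
  or in the radical into a test against linear forms.\<close>

lemma annihilator_separates:
  assumes "subspace S" "\<forall>a\<in>annihilator scale S. a x = 0"
  shows "x \<in> S"
proof (rule ccontr)
  assume "x \<notin> S"
  obtain B where B: "B \<subseteq> S" "independent B" "S \<subseteq> span B"
    using maximal_independent_subset[of S] by auto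
  then have S: "span B = S"
    using assms(1) span_minimal by blast
  then have "independent (insert x B)"
    using B(2) \<open>x \<notin> S\<close> by (simp add: independent_insertI)
  then obtain g where g: "g \<in> dual_space scale" "\<forall>y\<in>insert x B. g y = (if y = x then 1 else 0)"
    using vector_space_pair.linear_independent_extend[OF vector_space_pair_field,
        of "insert x B" "\<lambda>y. if y = x then 1 else 0"]
    by (auto simp: dual_space_def)
  have "\<forall>y\<in>B. g y = 0"
    using g(2) B(1) \<open>x \<notin> S\<close> by auto
  then have "g y = 0" if "y \<in> S" for y
    using linear_form_on_eq_span[of B g "\<lambda>_. 0" y] that S linear_form_on_dual_space[OF g(1)]
    by (simp add: linear_form_on_def)
  then have "g \<in> annihilator scale S"
    using g(1) by (simp add: annihilator_def)
  then show False
    using assms(2) g(2) by auto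
qed

section \<open>Linear forms vanishing on a common kernel\<close>

lemma linear_form_on_sub_scaled:
  assumes "linear_form_on scale S f" "linear_form_on scale S g"
  shows "linear_form_on scale S (\<lambda>y. f y - k * g y)"
  using assms by (simp add: linear_form_on_def algebra_simps)

text \<open>On the common kernel of the forms other than \<open>f t\<close>, the form
  \<open>a\<close> is a multiple of \<open>f t\<close>. Subtracting that multiple leaves a form to
  which the induction hypothesis applies.\<close>

lemma linear_form_on_combination:
  assumes "finite I" "subspace S"
    and "\<And>i. i \<in> I \<Longrightarrow> linear_form_on scale S (f i)"
    and "linear_form_on scale S a"
    and "\<And>y. y \<in> S \<Longrightarrow> \<forall>i\<in>I. f i y = 0 \<Longrightarrow> a y = 0"
  shows "\<exists>u. \<forall>y\<in>S. a y = (\<Sum>i\<in>I. u i * f i y)"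
  using assms(1,3,4,5)
proof (induction I arbitrary: a rule: finite_induct)
  case empty
  then show ?case by simp
next
  case (insert t I)
  have ft: "linear_form_on scale S (f t)"
    using insert.prems by blast
  obtain k where k: "\<And>y. y \<in> S \<Longrightarrow> \<forall>i\<in>I. f i y = 0 \<Longrightarrow> a y - k * f t y = 0"
  proof (cases "\<forall>y\<in>S. (\<forall>i\<in>I. f i y = 0) \<longrightarrow> f t y = 0")
    case True
    then show thesis
      using insert.prems(3) that[of 0] by simp
  next
    case False
    then obtain z where z: "z \<in> S" "\<forall>i\<in>I. f i z = 0" "f t z \<noteq> 0"
      by blast
    show thesis
    \<comment> \<open>Evaluation at \<open>z\<close> forces this coefficient. Subtracting from
      \<open>y\<close> the multiple \<open>w\<close> of \<open>z\<close> with the same value under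
      \<open>f t\<close> gives a vector killed by all the forms, hence by \<open>a\<close>.\<close>
    proof (rule that[of "a z / f t z"])
      fix y assume y: "y \<in> S" "\<forall>i\<in>I. f i y = 0"
      define w where "w = scale (f t y / f t z) z"
      have w: "w \<in> S"
        using z assms(2) by (simp add: w_def subspace_scale)
      have fw: "g w = f t y / f t z * g z" if "linear_form_on scale S g" for g
        using linear_form_on_scale[OF that z(1)] by (simp add: w_def)
      have fyw: "g (y - w) = g y - f t y / f t z * g z" if "linear_form_on scale S g" for g
        using linear_form_on_diff[OF assms(2) that y(1) w] fw[OF that] by simp
      have "f i (y - w) = 0" if "i \<in> insert t I" for i
        using fyw[OF insert.prems(1)[OF that]] that y z by auto
      then have "a (y - w) = 0"
        using insert.prems(3)[of "y - w"] subspace_diff[OF assms(2) y(1) w] by blast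
      then show "a y - a z / f t z * f t y = 0"
        using fyw[OF insert.prems(2)] by simp
    qed
  qed
  obtain u where u: "\<forall>y\<in>S. a y - k * f t y = (\<Sum>i\<in>I. u i * f i y)"
    using insert.IH[of "\<lambda>y. a y - k * f t y"] insert.prems(1)
      linear_form_on_sub_scaled[OF insert.prems(2) ft] k by blast
  have "\<forall>y\<in>S. a y = (\<Sum>i\<in>insert t I. (u(t := k)) i * f i y)"
  proof
    fix y assume "y \<in> S"
    have "(\<Sum>i\<in>I. (u(t := k)) i * f i y) = (\<Sum>i\<in>I. u i * f i y)"
      using insert.hyps by (intro sum.cong) auto
    then show "a y = (\<Sum>i\<in>insert t I. (u(t := k)) i * f i y)"
      using u \<open>y \<in> S\<close> insert.hyps by (simp add: algebra_simps)
  qed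
  then show ?case by blast
qed

lemma linear_form_on_sum:
  assumes "subspace S" "linear_form_on scale S g" "finite T" "T \<subseteq> S"
  shows "g (\<Sum>t\<in>T. scale (u t) t) = (\<Sum>t\<in>T. u t * g t)"
  using assms(3,4)
proof (induction T rule: finite_induct)
  case empty
  then show ?case using linear_form_on_0[OF assms(1,2)] by simp
next
  case (insert x T)
  have "(\<Sum>t\<in>T. scale (u t) t) \<in> S"
    using insert.prems assms(1) by (intro subspace_sum subspace_scale) auto
  moreover have "scale (u x) x \<in> S"
    using insert.prems assms(1) by (simp add: subspace_scale)
  ultimately show ?case
    using insert assms(2) by (simp add: linear_form_on_add linear_form_on_scale)
qed

lemma transpose_map_in_dual_space:
  assumes "Vector_Spaces.linear scale scale \<psi>" "a \<in> dual_space scale"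
  shows "transpose_map \<psi> a \<in> dual_space scale"
proof -
  interpret \<psi>: Vector_Spaces.linear scale scale \<psi> by fact
  show ?thesis
    using assms(2) by (simp add: dual_space_iff linear_form_on_def transpose_map_def \<psi>.add \<psi>.scale)
qed

end

section \<open>The dual quadratic form\<close>

lemma polar_commute: "polar Q x y = polar Q y x"
  by (simp add: polar_def add.commute)

locale quadratic_space = finite_dimensional_vector_space scale Basis
  for scale :: "'f::field \<Rightarrow> 'v::ab_group_add \<Rightarrow> 'v" and Basis :: "'v set" +
  fixes S :: "'v set" and Q :: "'v \<Rightarrow> 'f"
  assumes subspace_S: "subspace S"
    and quadratic: "quadratic_form_on scale S Q"
    and Q_radical: "x \<in> radical S Q \<Longrightarrow> Q x = 0"
begin

lemma Q_scale: "x \<in> S \<Longrightarrow> Q (scale k x) = k\<^sup>2 * Q x"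
  using quadratic by (simp add: quadratic_form_on_def)

lemma linear_polar: "x \<in> S \<Longrightarrow> linear_form_on scale S (polar Q x)"
  using quadratic by (simp add: quadratic_form_on_def bilinear_form_on_def)

lemma polar_add_left:
  "x \<in> S \<Longrightarrow> x' \<in> S \<Longrightarrow> y \<in> S \<Longrightarrow> polar Q (x + x') y = polar Q x y + polar Q x' y"
  using linear_form_on_add[OF linear_polar] by (metis polar_commute)

lemma polar_diff_left:
  "x \<in> S \<Longrightarrow> x' \<in> S \<Longrightarrow> y \<in> S \<Longrightarrow> polar Q (x - x') y = polar Q x y - polar Q x' y"
  using linear_form_on_diff[OF subspace_S linear_polar] by (metis polar_commute)

lemma polar_scale_left:
  "x \<in> S \<Longrightarrow> y \<in> S \<Longrightarrow> polar Q (scale k x) y = k * polar Q x y"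
  using linear_form_on_scale[OF linear_polar] by (metis polar_commute)

lemma polar_0_left: "y \<in> S \<Longrightarrow> polar Q 0 y = 0"
  using linear_form_on_0[OF subspace_S linear_polar] by (metis polar_commute)

lemma subspace_radical: "subspace (radical S Q)"
  using subspace_S
  by (auto simp: subspace_def radical_def polar_0_left polar_add_left polar_scale_left)

text \<open>Since (x - y) + y = x, the polar form at (x - y, y) is Q x - Q (x - y) - Q y; both it
  and Q (x - y) vanish.\<close>

lemma Q_eq_if_diff_radical:
  assumes "x \<in> S" "y \<in> S" "x - y \<in> radical S Q"
  shows "Q x = Q y"
proof -
  have "polar Q (x - y) y = 0"
    using assms by (simp add: radical_def)
  then show ?thesis
    using Q_radical[OF assms(3)] by (simp add: polar_def)
qed

section \<open>Links between linear forms and vectors\<close>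

lemma linked_unique:
  assumes "x \<in> S" "y \<in> S" "linked S Q a x" "linked S Q a y"
  shows "Q x = Q y"
  using assms subspace_diff[OF subspace_S]
  by (intro Q_eq_if_diff_radical) (auto simp: radical_def polar_diff_left linked_def)

text \<open>For a basis \<open>T\<close> of \<open>S\<close>, the radical is the common kernel in
  \<open>S\<close> of the forms \<open>polar Q t\<close>. As \<open>a\<close> vanishes there, it is
  a combination of them on \<open>S\<close>, and the same combination of the vectors
  \<open>t\<close> is linked to \<open>a\<close>. Finite dimension enters through the finiteness of
  \<open>T\<close>.\<close>

lemma linked_to_vector:
  assumes a: "a \<in> dual_domain scale S Q"
  obtains x where "x \<in> S" "linked S Q a x"
proof -
  obtain T where T: "T \<subseteq> S" "independent T" "S \<subseteq> span T"
    using maximal_independent_subset[of S] by auto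
  have fin: "finite T"
    using T(2) by (rule finiteI_independent)
  have span: "span T = S"
    using T subspace_S span_minimal by blast
  have "a y = 0" if y: "y \<in> S" "\<forall>t\<in>T. polar Q t y = 0" for y
  proof -
    have "polar Q y z = 0" if "z \<in> S" for z
      using linear_form_on_eq_span[of T "polar Q y" "\<lambda>_. 0" z] linear_polar[OF y(1)] y(2) that span
      by (simp add: linear_form_on_def polar_commute)
    then show ?thesis
      using a y(1) by (simp add: dual_domain_def annihilator_def radical_def)
  qed
  then obtain u where u: "\<forall>y\<in>S. a y = (\<Sum>t\<in>T. u t * polar Q t y)"
    using linear_form_on_combination[OF fin subspace_S, of "polar Q" a] linear_polar T(1) a
      linear_form_on_dual_space[of a S]
    by (auto simp: dual_domain_def annihilator_def)
  define x where "x = (\<Sum>t\<in>T. scale (u t) t)"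
  have "polar Q x y = (\<Sum>t\<in>T. u t * polar Q t y)" if "y \<in> S" for y
    using linear_form_on_sum[OF subspace_S linear_polar[OF that] fin T(1), of u]
    by (simp add: x_def polar_commute)
  moreover have "x \<in> S"
    unfolding x_def using T(1) subspace_S by (intro subspace_sum subspace_scale) auto
  ultimately show thesis
    using that u by (simp add: linked_def)
qed

lemma linked_to_form:
  assumes "x \<in> S"
  obtains a where "a \<in> dual_domain scale S Q" "linked S Q a x"
proof -
  obtain a where a: "a \<in> dual_space scale" "\<forall>y\<in>S. a y = polar Q x y"
    using linear_form_on_extend[OF subspace_S linear_polar[OF assms]] .
  then have "a \<in> dual_domain scale S Q"
    using assms by (auto simp: dual_domain_def annihilator_def radical_def polar_commute[of Q x])
  then show thesis
    using that a(2) by (simp add: linked_def)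
qed

text \<open>Gives access to the value behind the definite description. A choice of linked vector
  proves existence, by \<open>linked_unique\<close>; uniqueness holds because every form in the
  domain has a linked vector.\<close>

lemma dual_quadratic_form_linked:
  assumes "a \<in> dual_domain scale S Q" "x \<in> S" "linked S Q a x"
  shows "dual_quadratic_form scale S Q a = Q x"
proof -
  let ?D = "dual_domain scale S Q"
  let ?P = "\<lambda>Q'. Q' \<in> extensional ?D \<and> (\<forall>a\<in>?D. \<forall>x\<in>S. linked S Q a x \<longrightarrow> Q' a = Q x)"
  have "\<exists>Q'. ?P Q'"
  proof
    show "?P (\<lambda>a\<in>?D. Q (SOME x. x \<in> S \<and> linked S Q a x))"
    proof (intro conjI ballI impI)
      fix a x assume *: "a \<in> ?D" "x \<in> S" "linked S Q a x"
      then have "(SOME x. x \<in> S \<and> linked S Q a x) \<in> S \<and>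
          linked S Q a (SOME x. x \<in> S \<and> linked S Q a x)"
        by (intro someI[of "\<lambda>x. x \<in> S \<and> linked S Q a x"]) simp
      then show "(\<lambda>a\<in>?D. Q (SOME x. x \<in> S \<and> linked S Q a x)) a = Q x"
        using linked_unique[OF _ *(2) _ *(3)] *(1) by (metis restrict_apply')
    qed simp
  qed
  moreover have "Q1 = Q2" if "?P Q1" "?P Q2" for Q1 Q2
  proof (rule extensionalityI[of _ ?D])
    fix a assume "a \<in> ?D"
    moreover from this obtain x where "x \<in> S" "linked S Q a x"
      by (rule linked_to_vector)
    ultimately show "Q1 a = Q2 a"
      using that by metis
  qed (use that in auto)
  ultimately have "\<exists>!Q'. ?P Q'"
    by blast
  then have "?P (dual_quadratic_form scale S Q)"
    unfolding dual_quadratic_form_def by (rule theI')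
  then show ?thesis
    using assms by blast
qed

lemma dual_domain_add:
  assumes "a \<in> dual_domain scale S Q" "b \<in> dual_domain scale S Q"
  shows "(\<lambda>v. a v + b v) \<in> dual_domain scale S Q"
  using assms
  by (simp add: dual_domain_def annihilator_def dual_space_iff linear_form_on_def algebra_simps)

lemma linked_add:
  assumes "x \<in> S" "y \<in> S" "linked S Q a x" "linked S Q b y"
  shows "linked S Q (\<lambda>v. a v + b v) (x + y)"
  using assms by (simp add: linked_def polar_add_left)

text \<open>Links add, so the right-hand side, the polar form of the dual form at (a, b), can be
  evaluated at linked vectors.\<close>

lemma polar_eq_dual_quadratic_form:
  assumes "a \<in> dual_domain scale S Q" "b \<in> dual_domain scale S Q"
    and "x \<in> S" "y \<in> S" "linked S Q a x" "linked S Q b y"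
  shows "polar Q x y = dual_quadratic_form scale S Q (\<lambda>v. a v + b v)
    - dual_quadratic_form scale S Q a - dual_quadratic_form scale S Q b"
  using dual_quadratic_form_linked[OF dual_domain_add[OF assms(1,2)]
      subspace_add[OF subspace_S assms(3,4)] linked_add[OF assms(3-6)]]
    dual_quadratic_form_linked[OF assms(1,3,5)] dual_quadratic_form_linked[OF assms(2,4,6)]
  by (simp add: polar_def)

end

section \<open>Similitudes\<close>

locale quadratic_space_with_bijection = quadratic_space scale Basis S Q
  for scale :: "'f::field \<Rightarrow> 'v::ab_group_add \<Rightarrow> 'v" and Basis S Q +
  fixes \<psi> :: "'v \<Rightarrow> 'v" and c :: 'f
  assumes linear_\<psi>: "Vector_Spaces.linear scale scale \<psi>"
    and bij_\<psi>: "bij \<psi>"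
    and c_nonzero: "c \<noteq> 0"
begin

sublocale \<psi>: Vector_Spaces.linear scale scale \<psi>
  by (fact linear_\<psi>)

lemma linear_inv: "Vector_Spaces.linear scale scale (inv \<psi>)"
proof -
  have "inv \<psi> (x + y) = inv \<psi> x + inv \<psi> y" for x y
    using bij_\<psi> \<psi>.add by (metis bij_inv_eq_iff)
  moreover have "inv \<psi> (scale k x) = scale k (inv \<psi> x)" for k x
    using bij_\<psi> \<psi>.scale by (metis bij_inv_eq_iff)
  ultimately show ?thesis
    by (simp add: linear_iff vector_space_axioms)
qed

lemma transpose_map_inv: "transpose_map \<psi> (transpose_map (inv \<psi>) a) = a"
  using bij_\<psi> by (simp add: transpose_map_def fun_eq_iff bij_is_inj)

section \<open>From a similitude to its transpose\<close>

lemma dual_similitude: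
  assumes S: "\<psi> ` S = S" and Q: "\<forall>x\<in>S. Q (\<psi> x) = c * Q x"
  shows "transpose_map \<psi> ` dual_domain scale S Q = dual_domain scale S Q"
    and "a \<in> dual_domain scale S Q \<Longrightarrow>
      dual_quadratic_form scale S Q (transpose_map \<psi> a) = c * dual_quadratic_form scale S Q a"
proof -
  let ?D = "dual_domain scale S Q"
  have mem: "\<psi> x \<in> S \<longleftrightarrow> x \<in> S" for x
    using S bij_\<psi> by (metis bij_is_inj inj_image_mem_iff)
  have polar: "polar Q (\<psi> x) (\<psi> y) = c * polar Q x y" if "x \<in> S" "y \<in> S" for x y
  proof -
    have "x + y \<in> S" using that subspace_add[OF subspace_S] by blast
    then have "Q (\<psi> x + \<psi> y) = c * Q (x + y)" using Q by (metis \<psi>.add)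
    then show ?thesis using that Q by (simp add: polar_def algebra_simps)
  qed
  \<comment> \<open>As \<psi> maps \<open>S\<close> onto itself, the test vectors may be taken of
    the form \<open>\<psi> y\<close>; then the nonzero factor \<open>c\<close> cancels.\<close>
  have rad: "\<psi> x \<in> radical S Q \<longleftrightarrow> x \<in> radical S Q" for x
  proof -
    have "(\<forall>z\<in>S. polar Q (\<psi> x) z = 0) \<longleftrightarrow> (\<forall>y\<in>S. polar Q (\<psi> x) (\<psi> y) = 0)"
      using S by (metis (no_types, lifting) imageE image_eqI)
    then show ?thesis
      using polar c_nonzero by (auto simp: radical_def mem)
  qed
  have radinv: "inv \<psi> x \<in> radical S Q" if "x \<in> radical S Q" for x
    using that rad bij_\<psi> by (metis bij_inv_eq_iff)
  have tr: "transpose_map \<psi> a \<in> ?D" if "a \<in> ?D" for a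
    using that rad transpose_map_in_dual_space[OF linear_\<psi>, of a]
    by (auto simp: dual_domain_def annihilator_def transpose_map_def)
  \<comment> \<open>This supplies the preimage of \<open>a\<close> under the transpose, giving
    surjectivity.\<close>
  have "transpose_map (inv \<psi>) a \<in> ?D" if "a \<in> ?D" for a
    using that radinv transpose_map_in_dual_space[OF linear_inv, of a]
    by (auto simp: dual_domain_def annihilator_def transpose_map_def)
  then show "transpose_map \<psi> ` ?D = ?D"
    using tr transpose_map_inv by (metis image_subsetI subsetI subset_antisym image_eqI)
  show "dual_quadratic_form scale S Q (transpose_map \<psi> a) = c * dual_quadratic_form scale S Q a"
    if a: "a \<in> ?D"
  proof -
    obtain x where x: "x \<in> S" "linked S Q a x"
      using linked_to_vector[OF a] .
    obtain z where z: "z \<in> S" "x = \<psi> z"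
      using x(1) S by blast
    \<comment> \<open>With B the polar form, a (\<psi> y) = B (\<psi> z, \<psi> y) = c B (z, y) = B
      (c z, y) for y in \<open>S\<close>.\<close>
    have "linked S Q (transpose_map \<psi> a) (scale c z)"
      using x(2) z by (simp add: linked_def transpose_map_def polar polar_scale_left mem)
    then have "dual_quadratic_form scale S Q (transpose_map \<psi> a) = c\<^sup>2 * Q z"
      using dual_quadratic_form_linked[OF tr[OF a]] Q_scale z(1) subspace_scale[OF subspace_S]
      by metis
    also have "\<dots> = c * Q x"
      using z Q by (simp add: power2_eq_square)
    finally show ?thesis
      using dual_quadratic_form_linked[OF a x] by simp
  qed
qed

section \<open>From a similitude of the dual form back to the form\<close>

lemma similitude_if_dual_similitude:
  assumes D: "transpose_map \<psi> ` dual_domain scale S Q = dual_domain scale S Q"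
    and dual: "\<forall>a\<in>dual_domain scale S Q.
      dual_quadratic_form scale S Q (transpose_map \<psi> a) = c * dual_quadratic_form scale S Q a"
  shows "\<psi> ` S = S" and "x \<in> S \<Longrightarrow> Q (\<psi> x) = c * Q x"
proof -
  let ?D = "dual_domain scale S Q"
  let ?t = "transpose_map \<psi>"
  have t: "?t a \<in> ?D" if "a \<in> ?D" for a
    using D that by blast
  have t_add: "?t (\<lambda>v. a v + b v) = (\<lambda>v. ?t a v + ?t b v)" for a b :: "'v \<Rightarrow> 'f"
    by (auto simp: transpose_map_def)
  \<comment> \<open>The polar form of the dual form is also multiplied by \<open>c\<close> under the
    transpose; this is that identity read off at linked vectors.\<close>
  have polar: "polar Q x' y' = c * polar Q x y"
    if "a \<in> ?D" "b \<in> ?D" "x \<in> S" "y \<in> S" "x' \<in> S" "y' \<in> S"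
      and "linked S Q a x" "linked S Q b y" "linked S Q (?t a) x'" "linked S Q (?t b) y'"
    for a b x y x' y'
    using polar_eq_dual_quadratic_form[of a b x y] polar_eq_dual_quadratic_form[of "?t a" "?t b" x' y']
      that t dual dual_domain_add[OF that(1,2)]
    by (simp flip: t_add add: right_diff_distrib)
  \<comment> \<open>Being linked to 0 puts \<open>a\<close> in the radical of the dual polar
    form.\<close>
  have annD: "a \<in> ?D" "linked S Q a 0" if "a \<in> annihilator scale S" for a
    using that by (auto simp: dual_domain_def annihilator_def radical_def linked_def polar_0_left)
  have zero: "0 \<in> S"
    using subspace_0[OF subspace_S] .
  have fwd: "\<psi> y \<in> S" if y: "y \<in> S" for y
  proof (rule annihilator_separates[OF subspace_S], rule ballI)
    fix a assume a: "a \<in> annihilator scale S"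
    \<comment> \<open>Surjectivity of the transpose lets the form linked to \<open>y\<close> be
      written as \<open>?t b\<close>. Then a (\<psi> y) is the dual polar form at
      \<open>?t a\<close> and \<open>?t b\<close>, that is \<open>c\<close> times its value at (a,
      b), which is 0.\<close>
    obtain b where b: "?t b \<in> ?D" "b \<in> ?D" "linked S Q (?t b) y"
      using linked_to_form[OF y] D by (metis imageE)
    obtain z where z: "z \<in> S" "linked S Q b z"
      using linked_to_vector[OF b(2)] .
    obtain x' where x': "x' \<in> S" "linked S Q (?t a) x'"
      using linked_to_vector[OF t[OF annD(1)[OF a]]] .
    have "polar Q x' y = c * polar Q 0 z"
      using polar[OF annD(1)[OF a] b(2) zero z(1) x'(1) y annD(2)[OF a] z(2) x'(2) b(3)] .
    then show "a (\<psi> y) = 0"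
      using x'(2) y z(1) by (simp add: linked_def transpose_map_def polar_0_left)
  qed
  have bwd: "y \<in> S" if y: "\<psi> y \<in> S" for y
  proof (rule annihilator_separates[OF subspace_S], rule ballI)
    fix a assume a: "a \<in> annihilator scale S"
    \<comment> \<open>Now a y = a0 (\<psi> y), and \<open>c\<close> times this is the dual polar
      form at \<open>a\<close> and \<open>?t b\<close>, which vanishes because \<open>a\<close> is
      linked to 0.\<close>
    obtain a0 where a0: "a0 \<in> ?D" "a = ?t a0"
      using annD(1)[OF a] D by (metis imageE)
    obtain x0 where x0: "x0 \<in> S" "linked S Q a0 x0"
      using linked_to_vector[OF a0(1)] .
    obtain b where b: "b \<in> ?D" "linked S Q b (\<psi> y)"
      using linked_to_form[OF y] .
    obtain y' where y': "y' \<in> S" "linked S Q (?t b) y'"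
      using linked_to_vector[OF t[OF b(1)]] .
    have "polar Q 0 y' = c * polar Q x0 (\<psi> y)"
      using polar[OF a0(1) b(1) x0(1) y zero y'(1) x0(2) b(2) _ y'(2)] annD(2)[OF a] a0(2) by simp
    then show "a y = 0"
      using x0(2) y y'(1) c_nonzero a0(2) by (simp add: linked_def transpose_map_def polar_0_left)
  qed
  show image: "\<psi> ` S = S"
    using fwd bwd bij_\<psi> by (metis bij_pointE image_subsetI subsetI subset_antisym image_eqI)
  have rad: "v \<in> radical S Q" if v: "\<psi> v \<in> radical S Q" for v
  proof (rule annihilator_separates[OF subspace_radical], rule ballI)
    fix b assume "b \<in> annihilator scale (radical S Q)"
    then obtain b0 where "b0 \<in> ?D" "b = ?t b0"
      using D unfolding dual_domain_def by blast
    then show "b v = 0"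
      using v by (simp add: dual_domain_def annihilator_def transpose_map_def)
  qed
  show "Q (\<psi> x) = c * Q x" if x: "x \<in> S"
  proof -
    obtain a where a: "a \<in> ?D" "linked S Q a (\<psi> x)"
      using linked_to_form[OF fwd[OF x]] .
    obtain x' where x': "x' \<in> S" "linked S Q (?t a) x'"
      using linked_to_vector[OF t[OF a(1)]] .
    have cx: "scale c x \<in> S"
      using subspace_scale[OF subspace_S x] .
    \<comment> \<open>Shown after applying \<psi>, because forms \<open>b\<close> in the domain then
      act through \<open>?t b\<close>: b (\<psi> x') = B (x', y') = c B (\<psi> x, y) = c b (\<psi>
      x). The fact \<open>rad\<close> removes \<psi> afterwards.\<close>
    have "\<psi> (scale c x - x') \<in> radical S Q"
    proof (rule annihilator_separates[OF subspace_radical], rule ballI)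
      fix b assume "b \<in> annihilator scale (radical S Q)"
      then have b: "b \<in> ?D" and lin: "linear_form_on scale UNIV b"
        by (auto simp: dual_domain_def annihilator_def dual_space_iff)
      obtain y where y: "y \<in> S" "linked S Q b y"
        using linked_to_vector[OF b] .
      obtain y' where y': "y' \<in> S" "linked S Q (?t b) y'"
        using linked_to_vector[OF t[OF b]] .
      have "polar Q x' y' = c * polar Q (\<psi> x) y"
        using polar[OF a(1) b fwd[OF x] y(1) x'(1) y'(1) a(2) y(2) x'(2) y'(2)] .
      then have "b (\<psi> x') = c * b (\<psi> x)"
        using y(2) y'(2) x'(1) fwd[OF x]
        by (simp add: linked_def transpose_map_def polar_commute)
      then show "b (\<psi> (scale c x - x')) = 0"
        using linear_form_on_diff[OF subspace_UNIV lin] linear_form_on_scale[OF lin]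
        by (simp add: \<psi>.diff \<psi>.scale)
    qed
    then have "Q (scale c x) = Q x'"
      using Q_eq_if_diff_radical[OF cx x'(1)] rad by blast
    moreover have "Q x' = c * Q (\<psi> x)"
      using dual_quadratic_form_linked[OF t[OF a(1)] x'] dual a(1)
        dual_quadratic_form_linked[OF a(1) fwd[OF x] a(2)] by simp
    ultimately show ?thesis
      using Q_scale[OF x] c_nonzero by (simp add: power2_eq_square)
  qed
qed

end

theorem theorem6p1:
  fixes scale :: "'f::field \<Rightarrow> 'v::ab_group_add \<Rightarrow> 'v"
    and Basis :: "'v set"
    and S :: "'v set"
    and Q :: "'v \<Rightarrow> 'f"
    and \<psi> :: "'v \<Rightarrow> 'v"
    and c :: 'f
  assumes "finite_dimensional_vector_space scale Basis"
    and "module.subspace scale S"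
    and "quadratic_form_on scale S Q"
    and "\<forall>x \<in> radical S Q - {0}. Q x = 0"
    and "\<psi> \<in> general_linear_group scale"
    and "c \<noteq> 0"
  shows "(\<psi> ` S = S \<and> (\<forall>x\<in>S. Q (\<psi> x) = c * Q x)) \<longleftrightarrow>
    (transpose_map \<psi> ` dual_domain scale S Q = dual_domain scale S Q \<and>
     (\<forall>a\<in>dual_domain scale S Q.
        dual_quadratic_form scale S Q (transpose_map \<psi> a) = c * dual_quadratic_form scale S Q a))"
proof -
  interpret finite_dimensional_vector_space scale Basis by fact
  \<comment> \<open>The hypothesis on the radical excludes 0, while the locale asks for all of it;
    homogeneity with scalar 0 fills the gap.\<close>
  have "Q 0 = 0"
    using assms(3) subspace_0[OF assms(2)] unfolding quadratic_form_on_def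
    by (metis mult_zero_left power_zero_numeral scale_zero_left)
  then interpret quadratic_space_with_bijection scale Basis S Q \<psi> c
    using assms by unfold_locales (auto simp: general_linear_group_def linear_iff)
  show ?thesis
    using dual_similitude similitude_if_dual_similitude by blast
qed

end
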